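(* Let $F: Q \to \mathbf{E}^*$ be a continuous, bounded (with constant $L_F$), and $\delta$-monotone operator. Let $m\ge 1$ be any fixed real number, $N\ge 1$, $x^1\in Q$, and let $x^1,\dots,x^N$ be generated by the mirror descent iteration $$x^{k+1} = \arg\min_{x \in Q} \left\{ \langle F(x^k), x \rangle + \frac{1}{\gamma_k} V_{\psi}(x,x^k) \right\},\qquad k=1,\dots,N,$$ with step sizes $\gamma_k = \frac{\sqrt{2 \sigma}}{L_F \sqrt{k}}$, $k=1,\dots,N$. Set $\widehat{x} = \frac{1}{\sum_{k= 1}^{N} \gamma_k^{-m}} \sum_{k = 1}^{N} \gamma_k^{-m} x^k$. Then $$\operatorname{Gap}(\widehat{x}) \leq \frac{L_F (m + 2) (1+ R)}{2 \sqrt{2 \sigma}} \cdot \frac{1}{\sqrt{N}} + \delta = O\left(\frac{1}{\sqrt{N}}\right) + \delta .$$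
   Context: $(\mathbf{E},\|\cdot\|)$ is a finite-dimensional normed real vector space (arbitrary norm), $\mathbf{E}^*$ its dual with norm $\|y\|_*=\max\{\langle y,x\rangle : \|x\|\le 1\}$, where $\langle y,x\rangle$ is the value of $y\in\mathbf{E}^*$ at $x\in\mathbf{E}$. $Q\subset\mathbf{E}$ is a (nonempty) convex compact set. The prox-function $\psi:Q\to\mathbb{R}$ is proper, closed, differentiable and $\sigma$-strongly convex ($\sigma>0$) with respect to $\|\cdot\|$; its Bregman divergence is $V_\psi(x,y)=\psi(x)-\psi(y)-\langle\nabla\psi(y),x-y\rangle$ for $x,y\in Q$. It is assumed that $R>0$ is a constant with $V_\psi(x,y)\le R<\infty$ for all $x,y\in Q$. The operator $F:Q\to\mathbf{E}^*$ is $\delta$-monotone if $\langle F(y)-F(x),y-x\rangle\ge-\delta$ for all $x,y\in Q$, where $\delta\ge 0$ (the case $\delta=0$ is ordinary monotonicity). It is bounded with constant $L_F>0$ if $\|F(x)\|_*\le L_F$ for all $x\in Q$. The underlying problem is to find $x^*\in Q$ with $\langle F(x),x^*-x\rangle\le 0$ for all $x\in Q$. The restricted gap function is $\operatorname{Gap}(\widehat{x})=\max_{u\in Q}\langle F(u),\widehat{x}-u\rangle$. $O(\cdot)$ refers to $N\to\infty$ with all other parameters fixed. *)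

theory Defs
  imports "HOL-Analysis.Analysis" "HOL-Library.Landau_Symbols"
begin

(* The space E is a type of class real_normed_vector whose norm is arbitrary; in finite
   dimension every linear functional is bounded, so the dual of E is 'a \<Rightarrow>\<^sub>L real,
   and its operator norm is the dual norm (see norm_dual_eq_SUP). *)

definition finite_dimensional :: "'a::real_vector itself \<Rightarrow> bool" where
  "finite_dimensional _ \<longleftrightarrow> (\<exists>B :: 'a set. finite B \<and> span B = UNIV)"

definition closed_function_on :: "'a::topological_space set \<Rightarrow> ('a \<Rightarrow> real) \<Rightarrow> bool" where
  "closed_function_on Q \<psi> \<longleftrightarrow> closed {(x, t). x \<in> Q \<and> \<psi> x \<le> t}"

definition strongly_convex_on ::
    "real \<Rightarrow> 'a::real_normed_vector set \<Rightarrow> ('a \<Rightarrow> real) \<Rightarrow> bool" where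
  "strongly_convex_on \<sigma> Q \<psi> \<longleftrightarrow> convex Q \<and>
     (\<forall>x\<in>Q. \<forall>y\<in>Q. \<forall>t\<in>{0..1}.
        \<psi> (t *\<^sub>R x + (1 - t) *\<^sub>R y)
          \<le> t * \<psi> x + (1 - t) * \<psi> y - \<sigma> / 2 * t * (1 - t) * (norm (x - y))\<^sup>2)"

(* Derivatives are taken relative to Q, so boundary points are allowed. If Q has empty interior,
   the derivative is not unique; d\<psi> is then any choice of gradient. *)
definition gradient_on ::
    "'a::real_normed_vector set \<Rightarrow> ('a \<Rightarrow> real) \<Rightarrow> ('a \<Rightarrow> 'a \<Rightarrow>\<^sub>L real) \<Rightarrow> bool" where
  "gradient_on Q \<psi> d\<psi> \<longleftrightarrow>
     (\<forall>x\<in>Q. (\<psi> has_derivative blinfun_apply (d\<psi> x)) (at x within Q))"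

definition bregman ::
    "('a::real_normed_vector \<Rightarrow> real) \<Rightarrow> ('a \<Rightarrow> 'a \<Rightarrow>\<^sub>L real) \<Rightarrow> 'a \<Rightarrow> 'a \<Rightarrow> real" where
  "bregman \<psi> d\<psi> x y = \<psi> x - \<psi> y - blinfun_apply (d\<psi> y) (x - y)"

definition delta_monotone_on ::
    "real \<Rightarrow> 'a::real_normed_vector set \<Rightarrow> ('a \<Rightarrow> 'a \<Rightarrow>\<^sub>L real) \<Rightarrow> bool" where
  "delta_monotone_on \<delta> Q F \<longleftrightarrow> (\<forall>x\<in>Q. \<forall>y\<in>Q. blinfun_apply (F y - F x) (y - x) \<ge> - \<delta>)"

(* For Q nonempty and compact and F continuous on Q the supremum is attained
   (see Gap_attained), so it is the maximum. *)
definition Gap ::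
    "'a::real_normed_vector set \<Rightarrow> ('a \<Rightarrow> 'a \<Rightarrow>\<^sub>L real) \<Rightarrow> 'a \<Rightarrow> real" where
  "Gap Q F x = (SUP u\<in>Q. blinfun_apply (F u) (x - u))"

lemma Gap_attained:
  assumes "compact Q" "Q \<noteq> {}" "continuous_on Q F"
  shows "\<exists>u\<in>Q. Gap Q F x = blinfun_apply (F u) (x - u) \<and>
           (\<forall>v\<in>Q. blinfun_apply (F v) (x - v) \<le> blinfun_apply (F u) (x - u))"
proof -
  have "continuous_on Q (\<lambda>u. blinfun_apply (F u) (x - u))"
    by (intro continuous_intros assms)
  then obtain u where u: "u \<in> Q"
    "\<forall>v\<in>Q. blinfun_apply (F v) (x - v) \<le> blinfun_apply (F u) (x - u)"
    using continuous_attains_sup[OF assms(1,2)] by blast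
  then have "Gap Q F x = blinfun_apply (F u) (x - u)"
    unfolding Gap_def by (intro cSup_eq_maximum) auto
  with u show ?thesis by blast
qed

lemma norm_dual_eq_SUP:
  fixes y :: "'a::real_normed_vector \<Rightarrow>\<^sub>L real"
  shows "norm y = (SUP x\<in>{x. norm x \<le> 1}. blinfun_apply y x)"
proof -
  let ?S = "SUP x\<in>{x. norm x \<le> 1}. blinfun_apply y x"
  have le: "blinfun_apply y x \<le> norm y" if "norm x \<le> 1" for x
  proof -
    have "blinfun_apply y x \<le> norm (blinfun_apply y x)" by simp
    also have "\<dots> \<le> norm y * norm x" by (rule norm_blinfun)
    also have "\<dots> \<le> norm y" using that by (simp add: mult_left_le)
    finally show ?thesis .
  qed
  then have bdd: "bdd_above (blinfun_apply y ` {x. norm x \<le> 1})"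
    by (intro bdd_aboveI2[where M = "norm y"]) auto
  have S: "blinfun_apply y x \<le> ?S" if "norm x \<le> 1" for x
    using that by (intro cSUP_upper bdd) auto
  show ?thesis
  proof (rule antisym)
    show "norm y \<le> ?S"
    proof (rule norm_blinfun_bound)
      show "0 \<le> ?S" using S[of 0] by (simp add: blinfun.zero_right)
      fix x
      show "norm (blinfun_apply y x) \<le> ?S * norm x"
      proof (cases "x = 0")
        case False
        have "blinfun_apply y (x /\<^sub>R norm x) \<le> ?S" "blinfun_apply y (- x /\<^sub>R norm x) \<le> ?S"
          using False by (auto intro!: S)
        then show ?thesis
          using False by (auto simp: blinfun.scaleR_right blinfun.minus_right field_simps abs_if)
      qed (simp add: blinfun.zero_right)
    qed
    show "?S \<le> norm y"
      by (rule cSUP_least) (auto intro: le exI[of _ 0])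
  qed
qed

end

theory Submission
  imports Defs
begin

text \<open>
  First-order optimality of a mirror descent step, strong convexity of \<open>\<psi>\<close> and Young's inequality
  give, with \<open>V\<^sub>k = V(u, x\<^sup>k)\<close>,
  \<open>\<gamma>\<^sub>k \<langle>F(x\<^sup>k), x\<^sup>k - u\<rangle> \<le> V\<^sub>k - V\<^sub>k\<^sub>+\<^sub>1 + \<gamma>\<^sub>k\<^sup>2 L\<^sub>F\<^sup>2 / (2\<sigma>)\<close>.
  Multiply by \<open>\<gamma>\<^sub>k\<close> to the power \<open>-m-1\<close> and sum: these weights increase with \<open>k\<close>, so summation by
  parts bounds the Bregman terms by \<open>R\<close> times the last weight. Writing \<open>\<gamma>\<^sub>k = c / \<surd>k\<close>,
  the total is at most \<open>(1 + R) (\<surd>N / c)\<close> to the power \<open>m+1\<close>, while comparison of \<open>\<Sum> k\<close> to the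
  power \<open>m/2\<close> with an integral bounds the normalising sum from below.
  Monotonicity up to \<open>\<delta>\<close> lets \<open>F(u)\<close> replace \<open>F(x\<^sup>k)\<close>.
\<close>

text \<open>Dividing the hypothesis by \<open>t\<close> bounds the difference quotient along the
  segment from \<open>y\<close> to \<open>z\<close> by \<open>a + b * t\<close>; now let
  \<open>t\<close> tend to 0 from the right. Only the segment inside \<open>Q\<close> is used, so
  boundary points and empty interior do no harm. It serves both strong convexity and the optimality
  condition.\<close>

lemma has_derivative_direction_le:
  fixes f :: "'a::real_normed_vector \<Rightarrow> real"
  assumes "convex Q" "y \<in> Q" "z \<in> Q"
    and der: "(f has_derivative D) (at y within Q)"
    and le: "\<And>t. 0 < t \<Longrightarrow> t \<le> 1 \<Longrightarrow> f (t *\<^sub>R z + (1 - t) *\<^sub>R y) - f y \<le> t * (a + b * t)"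
  shows "D (z - y) \<le> a"
proof -
  define p where "p t = t *\<^sub>R z + (1 - t) *\<^sub>R y" for t
  interpret D: bounded_linear D
    using der by (rule has_derivative_bounded_linear)
  have p0: "p 0 = y" by (simp add: p_def)
  have pQ: "p ` {0..1} \<subseteq> Q"
    using assms(1-3) by (auto simp: p_def convex_def)
  have "(p has_derivative (\<lambda>t. t *\<^sub>R (z - y))) (at 0 within {0..1})"
    unfolding p_def by (auto intro!: derivative_eq_intros simp: algebra_simps)
  moreover have "(f has_derivative D) (at (p 0) within p ` {0..1})"
    using has_derivative_subset[OF der pQ] by (simp add: p0)
  ultimately have "((\<lambda>t. f (p t)) has_derivative (\<lambda>t. D (t *\<^sub>R (z - y)))) (at 0 within {0..1})"
    by (rule has_derivative_in_compose)
  then have "((\<lambda>t. f (p t)) has_field_derivative D (z - y)) (at 0 within {0..1})"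
    by (simp add: has_field_derivative_def D.scaleR mult.commute[of _ "D (z - y)"] mult_commute_abs)
  then have lim: "((\<lambda>t. (f (p t) - f y) / t) \<longlongrightarrow> D (z - y)) (at 0 within {0..1})"
    by (simp add: has_field_derivative_iff p0)
  have "((\<lambda>t. a + b * t) \<longlongrightarrow> a + b * 0) (at 0 within {0..1})"
    by (intro tendsto_intros)
  moreover have "\<forall>\<^sub>F t in at 0 within {0..1}. (f (p t) - f y) / t \<le> a + b * t"
    unfolding eventually_at_filter
    using le by (intro always_eventually) (auto simp: pos_divide_le_eq mult.commute p_def)
  moreover have "at (0::real) within {0..1} \<noteq> bot"
    by (simp add: at_within_Icc_at_right trivial_limit_at_right_real)
  ultimately show ?thesis
    using tendsto_le[OF _ _ lim] by fastforce
qed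

text \<open>Near \<open>y\<close> the strong convexity slack \<open>t * (1 - t) * n\<close> is
  \<open>t * n\<close> to first order, so the directional derivative of \<open>\<psi>\<close> at
  \<open>y\<close> inherits the full \<open>n\<close>. This works for any admissible choice of
  gradient.\<close>

lemma bregman_lower_bound:
  assumes "gradient_on Q \<psi> d\<psi>" "strongly_convex_on \<sigma> Q \<psi>" "y \<in> Q" "z \<in> Q"
  shows "\<sigma> / 2 * (norm (z - y))\<^sup>2 \<le> bregman \<psi> d\<psi> z y"
proof -
  define n where "n = \<sigma> / 2 * (norm (z - y))\<^sup>2"
  have sc: "convex Q" "\<And>t. t \<in> {0..1} \<Longrightarrow>
      \<psi> (t *\<^sub>R z + (1 - t) *\<^sub>R y) \<le> t * \<psi> z + (1 - t) * \<psi> y - t * (1 - t) * n"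
    using assms(2-4) unfolding strongly_convex_on_def n_def by (fastforce simp: algebra_simps)+
  have "blinfun_apply (d\<psi> y) (z - y) \<le> \<psi> z - \<psi> y - n"
  proof (rule has_derivative_direction_le[OF sc(1) assms(3,4), where b = n])
    show "(\<psi> has_derivative blinfun_apply (d\<psi> y)) (at y within Q)"
      using assms by (auto simp: gradient_on_def)
    show "\<psi> (t *\<^sub>R z + (1 - t) *\<^sub>R y) - \<psi> y \<le> t * (\<psi> z - \<psi> y - n + n * t)"
      if "0 < t" "t \<le> 1" for t
      using sc(2)[of t] that by (auto simp: algebra_simps)
  qed
  then show ?thesis by (simp add: bregman_def n_def)
qed

text \<open>Optimality of \<open>w\<close> controls \<open>G\<close> on \<open>w - u\<close>, at the
  gain of \<open>- bregman \<psi> d\<psi> w y\<close>. The remaining part, \<open>G\<close> on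
  \<open>y - w\<close>, costs a square of \<open>norm (w - y)\<close>, which strong convexity lets
  this gain absorb.\<close>

lemma mirror_step:
  assumes "convex Q" and grad: "gradient_on Q \<psi> d\<psi>" and sc: "strongly_convex_on \<sigma> Q \<psi>"
    and "\<sigma> > 0" "g > 0" and y: "y \<in> Q" and u: "u \<in> Q" and "norm G \<le> L"
    and argmin: "is_arg_min (\<lambda>z. blinfun_apply G z + 1 / g * bregman \<psi> d\<psi> z y) (\<lambda>z. z \<in> Q) w"
  shows "g * blinfun_apply G (y - u)
    \<le> bregman \<psi> d\<psi> u y - bregman \<psi> d\<psi> u w + g\<^sup>2 * (L\<^sup>2 / (2 * \<sigma>))"
proof -
  define h where "h z = blinfun_apply G z + 1 / g * bregman \<psi> d\<psi> z y" for z
  have w: "w \<in> Q" and min: "h w \<le> h z" if "z \<in> Q" for z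
    using argmin that unfolding is_arg_min_def h_def by force+
  have "(\<psi> has_derivative blinfun_apply (d\<psi> w)) (at w within Q)"
    using grad w[OF y] by (auto simp: gradient_on_def)
  \<comment> \<open>The direction lemma bounds derivatives from above, hence the sign:
    \<open>- h\<close> does not increase from its maximiser \<open>w\<close> towards
    \<open>u\<close>, so it applies with \<open>a = b = 0\<close>.\<close>
  then have "((\<lambda>z. - h z) has_derivative
      (\<lambda>v. - (blinfun_apply G v + 1 / g * (blinfun_apply (d\<psi> w) v - blinfun_apply (d\<psi> y) v))))
      (at w within Q)"
    unfolding h_def bregman_def using \<open>g > 0\<close>
    by (auto intro!: derivative_eq_intros bounded_linear_imp_has_derivative blinfun.bounded_linear_right)
  then have "- (blinfun_apply G (u - w)
      + 1 / g * (blinfun_apply (d\<psi> w) (u - w) - blinfun_apply (d\<psi> y) (u - w))) \<le> 0"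
  proof (rule has_derivative_direction_le[OF \<open>convex Q\<close> w[OF y] u, where b = 0])
    show "- h (t *\<^sub>R u + (1 - t) *\<^sub>R w) - - h w \<le> t * (0 + 0 * t)" if "0 < t" "t \<le> 1" for t
      using min[of "t *\<^sub>R u + (1 - t) *\<^sub>R w"] that \<open>convex Q\<close> u w[OF y]
      by (auto simp: convex_def)
  qed
  then have opt: "g * blinfun_apply G (w - u)
      \<le> blinfun_apply (d\<psi> w) (u - w) - blinfun_apply (d\<psi> y) (u - w)"
    using \<open>g > 0\<close> by (simp add: blinfun.diff_right field_simps)
  have three_point: "blinfun_apply (d\<psi> w) (u - w) - blinfun_apply (d\<psi> y) (u - w)
      = bregman \<psi> d\<psi> u y - bregman \<psi> d\<psi> u w - bregman \<psi> d\<psi> w y"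
    by (simp add: bregman_def blinfun.diff_right)
  have "blinfun_apply G (y - w) \<le> norm G * norm (y - w)"
    using norm_blinfun[of G "y - w"] by simp
  also have "\<dots> \<le> L * norm (y - w)"
    using \<open>norm G \<le> L\<close> by (rule mult_right_mono) simp
  finally have "g * blinfun_apply G (y - w) \<le> g * L * norm (w - y)"
    using \<open>g > 0\<close> by (simp add: norm_minus_commute)
  also have "\<dots> \<le> g\<^sup>2 * (L\<^sup>2 / (2 * \<sigma>)) + \<sigma> / 2 * (norm (w - y))\<^sup>2"
  proof -
    \<comment> \<open>Young's inequality, scaled so that the quadratic term is exactly the lower
      bound for \<open>bregman \<psi> d\<psi> w y\<close>.\<close>
    have "0 \<le> (g * L - \<sigma> * norm (w - y))\<^sup>2 / (2 * \<sigma>)"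
      using \<open>\<sigma> > 0\<close> by simp
    then show ?thesis
      using \<open>\<sigma> > 0\<close> by (simp add: power2_eq_square field_simps)
  qed
  also have "\<dots> \<le> g\<^sup>2 * (L\<^sup>2 / (2 * \<sigma>)) + bregman \<psi> d\<psi> w y"
    using bregman_lower_bound[OF grad sc y w[OF y]] by simp
  finally show ?thesis
    using opt three_point by (simp add: blinfun.diff_right right_diff_distrib)
qed

text \<open>Keeping \<open>V (Suc N)\<close> in the bound makes the induction close: passing from
  \<open>n\<close> to \<open>Suc n\<close> leaves the slack
  \<open>(a (Suc n) - a n) * (R - V (Suc n))\<close>, which is nonnegative.\<close>

lemma sum_weighted_telescope_le:
  fixes a V :: "nat \<Rightarrow> real"
  assumes "N \<ge> 1"
    and "a 1 \<ge> 0"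
    and "\<And>k. 1 \<le> k \<Longrightarrow> k < N \<Longrightarrow> a k \<le> a (Suc k)"
    and "\<And>k. 1 \<le> k \<Longrightarrow> k \<le> N \<Longrightarrow> V k \<le> R"
  shows "(\<Sum>k=1..N. a k * (V k - V (Suc k))) \<le> a N * (R - V (Suc N))"
  using assms
proof (induction N rule: nat_induct_at_least)
  case base
  then show ?case by (simp add: mult_left_mono)
next
  case (Suc n)
  have "(a (Suc n) - a n) * (R - V (Suc n)) \<ge> 0"
    using Suc.prems Suc.hyps by simp
  with Suc show ?case by (simp add: algebra_simps)
qed

text \<open>By the mean value theorem the increment of \<open>t powr (p + 1)\<close> over the
  interval from \<open>n\<close> to \<open>n + 1\<close> is at most \<open>p + 1\<close> times the
  right endpoint to the power \<open>p\<close>; the increments telescope. For \<open>n = 0\<close>,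
  where differentiating \<open>powr\<close> at 0 is avoided, the claim is
  \<open>1 \<le> p + 1\<close>.\<close>

lemma sum_powr_lower_bound:
  fixes p :: real
  assumes "p \<ge> 0"
  shows "real N powr (p + 1) \<le> (p + 1) * (\<Sum>k=1..N. real k powr p)"
proof (induction N)
  case (Suc n)
  have "real (Suc n) powr (p + 1) - real n powr (p + 1) \<le> (p + 1) * real (Suc n) powr p"
  proof (cases "n = 0")
    case False
    have "\<exists>z>real n. z < real (Suc n) \<and>
        real (Suc n) powr (p + 1) - real n powr (p + 1)
          = (real (Suc n) - real n) * ((p + 1) * z powr p)"
    proof (rule MVT2)
      show "((\<lambda>t. t powr (p + 1)) has_real_derivative (p + 1) * t powr p) (at t)"
        if "real n \<le> t" for t
        using False that by (auto intro!: derivative_eq_intros)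
    qed simp
    then obtain z where "real n < z" "z < real (Suc n)"
      "real (Suc n) powr (p + 1) - real n powr (p + 1) = (p + 1) * z powr p"
      by auto
    moreover have "z powr p \<le> real (Suc n) powr p"
      using calculation assms by (intro powr_mono2) auto
    ultimately show ?thesis
      using assms by (simp add: mult_left_mono)
  qed (use assms in auto)
  then show ?case
    using Suc.IH by (simp add: distrib_left)
qed simp

theorem corollary3p8:
  fixes Q :: "'a::real_normed_vector set"
    and \<psi> :: "'a \<Rightarrow> real" and d\<psi> :: "'a \<Rightarrow> 'a \<Rightarrow>\<^sub>L real"
    and F :: "'a \<Rightarrow> 'a \<Rightarrow>\<^sub>L real"
    and \<sigma> R \<delta> L\<^sub>F m :: real
    and N :: nat
    and x :: "nat \<Rightarrow> 'a" and \<gamma> :: "nat \<Rightarrow> real" and xhat :: 'a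
  assumes "finite_dimensional TYPE('a)"
    and "Q \<noteq> {}" and "convex Q" and "compact Q"
    and "\<sigma> > 0" and "closed_function_on Q \<psi>" and "gradient_on Q \<psi> d\<psi>"
    and "strongly_convex_on \<sigma> Q \<psi>"
    and "R > 0" and "\<forall>u\<in>Q. \<forall>v\<in>Q. bregman \<psi> d\<psi> u v \<le> R"
    and "continuous_on Q F"
    and "L\<^sub>F > 0" and "\<forall>u\<in>Q. norm (F u) \<le> L\<^sub>F"
    and "\<delta> \<ge> 0" and "delta_monotone_on \<delta> Q F"
    and "m \<ge> 1" and "N \<ge> 1"
    and "x 1 \<in> Q"
    and "\<forall>k\<in>{1..N}. \<gamma> k = sqrt (2 * \<sigma>) / (L\<^sub>F * sqrt (real k))"
    and "\<forall>k\<in>{1..N}. is_arg_min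
           (\<lambda>z. blinfun_apply (F (x k)) z + 1 / \<gamma> k * bregman \<psi> d\<psi> z (x k))
           (\<lambda>z. z \<in> Q) (x (k + 1))"
    and "xhat = (1 / (\<Sum>k=1..N. \<gamma> k powr (- m))) *\<^sub>R (\<Sum>k=1..N. \<gamma> k powr (- m) *\<^sub>R x k)"
  shows "Gap Q F xhat
           \<le> L\<^sub>F * (m + 2) * (1 + R) / (2 * sqrt (2 * \<sigma>)) * (1 / sqrt (real N)) + \<delta> \<and>
         (\<lambda>n::nat. L\<^sub>F * (m + 2) * (1 + R) / (2 * sqrt (2 * \<sigma>)) * (1 / sqrt (real n)))
           \<in> O(\<lambda>n. 1 / sqrt (real n))"
proof
  define c where "c = sqrt (2 * \<sigma>) / L\<^sub>F"
  define w where "w k = \<gamma> k powr (- m)" for k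
  define K where "K = c powr (- m) / c"
  define W where "W = (\<Sum>k=1..N. w k)"
  define B where "B = L\<^sub>F * (m + 2) * (1 + R) / (2 * sqrt (2 * \<sigma>)) * (1 / sqrt (real N))"
  \<comment> \<open>With \<open>\<gamma> k = c / sqrt k\<close>, the error term of
    \<open>mirror_step\<close> becomes exactly \<open>1 / k\<close>. The constant \<open>K\<close>
    is \<open>c\<close> to the power \<open>-m-1\<close>.\<close>
  have c: "c > 0" and c2: "L\<^sub>F\<^sup>2 / (2 * \<sigma>) = 1 / c\<^sup>2"
    using assms(5,12) by (auto simp: c_def power_divide)
  have K: "K > 0" using c by (simp add: K_def)
  have \<gamma>: "\<gamma> k = c / sqrt (real k)" if "k \<in> {1..N}" for k
    using assms(19) that by (simp add: c_def)
  have w: "w k = c * K * real k powr (m / 2)" "w k > 0"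
    and w_div: "w k / \<gamma> k = K * real k powr ((m + 1) / 2)"
    and w_mult: "w k * \<gamma> k * (1 / c\<^sup>2) = K * real k powr ((m - 1) / 2)"
    if k: "k \<in> {1..N}" for k
  proof -
    have "w k = c powr (- m) / sqrt (real k) powr (- m)"
      using c k by (simp add: w_def \<gamma> powr_divide)
    also have "sqrt (real k) powr (- m) = 1 / real k powr (m / 2)"
      using k by (simp add: powr_half_sqrt[symmetric] powr_powr powr_minus_divide)
    finally show wk: "w k = c * K * real k powr (m / 2)"
      using c by (simp add: K_def)
    then show "w k > 0" using c K k by simp
    have "real k powr ((m + 1) / 2) = real k powr (m / 2) * sqrt (real k)"
      using k by (simp add: powr_half_sqrt[symmetric] powr_add[symmetric] add_divide_distrib)
    then show "w k / \<gamma> k = K * real k powr ((m + 1) / 2)"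
      using c by (simp add: \<gamma>[OF k] wk)
    have "real k powr ((m - 1) / 2) = real k powr (m / 2) / sqrt (real k)"
      using k by (simp add: powr_half_sqrt[symmetric] powr_diff[symmetric] diff_divide_distrib)
    then show "w k * \<gamma> k * (1 / c\<^sup>2) = K * real k powr ((m - 1) / 2)"
      using c by (simp add: \<gamma>[OF k] wk power2_eq_square)
  qed
  \<comment> \<open>The range includes \<open>N + 1\<close> because \<open>V (Suc N)\<close>
    survives the summation by parts.\<close>
  have xQ: "x k \<in> Q" if "k \<in> {1..N + 1}" for k
  proof (cases "k = 1")
    case False
    then have "k - 1 \<in> {1..N}" using that by auto
    then have "x (k - 1 + 1) \<in> Q"
      using assms(20) unfolding is_arg_min_def by blast
    then show ?thesis using that by simp
  qed (use assms(18) in simp)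
  have W: "W > 0" unfolding W_def
    using w(2) \<open>N \<ge> 1\<close> by (intro sum_pos) auto
  \<comment> \<open>The left side is the total error before normalisation: \<open>R\<close> stands
    for the Bregman terms and 1 for the Young terms. The factor \<open>(m + 2) / 2\<close> in
    \<open>B\<close> is \<open>p + 1\<close> for \<open>p = m / 2\<close> in
    \<open>sum_powr_lower_bound\<close>.\<close>
  have B: "K * real N powr ((m + 1) / 2) * (1 + R) \<le> B * W"
  proof -
    have "real N powr (m / 2 + 1) \<le> (m / 2 + 1) * (\<Sum>k=1..N. real k powr (m / 2))"
      using \<open>m \<ge> 1\<close> by (intro sum_powr_lower_bound) simp
    moreover have "W = c * K * (\<Sum>k=1..N. real k powr (m / 2))"
      by (simp add: W_def w(1) sum_distrib_left)
    ultimately have "c * K * real N powr (m / 2 + 1) \<le> (m / 2 + 1) * W"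
      using c K by (simp add: mult.left_commute[of _ "c * K"])
    moreover have "real N powr (m / 2 + 1) = real N powr ((m + 1) / 2) * sqrt (real N)"
      by (simp add: powr_half_sqrt[symmetric] powr_add[symmetric] add_divide_distrib add.commute)
    moreover have "(1 + R) / (c * sqrt (real N)) \<ge> 0"
      using c \<open>R > 0\<close> by simp
    ultimately have "c * K * (real N powr ((m + 1) / 2) * sqrt (real N)) * ((1 + R) / (c * sqrt (real N)))
        \<le> (m / 2 + 1) * W * ((1 + R) / (c * sqrt (real N)))"
      by (intro mult_right_mono) simp_all
    moreover have "(m / 2 + 1) * W * ((1 + R) / (c * sqrt (real N))) = B * W"
      using assms(5,12) by (simp add: B_def c_def field_simps)
    ultimately show ?thesis using c \<open>N \<ge> 1\<close> by simp
  qed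
  have "blinfun_apply (F u) (xhat - u) \<le> B + \<delta>" if u: "u \<in> Q" for u
  proof -
    define V where "V k = bregman \<psi> d\<psi> u (x k)" for k
    have "w k * blinfun_apply (F u) (x k - u)
        \<le> w k / \<gamma> k * (V k - V (Suc k)) + K * real N powr ((m - 1) / 2) + \<delta> * w k"
      if k: "k \<in> {1..N}" for k
    proof -
      have gk: "\<gamma> k > 0" using k c by (simp add: \<gamma>)
      have "\<gamma> k * blinfun_apply (F (x k)) (x k - u)
          \<le> V k - V (Suc k) + (\<gamma> k)\<^sup>2 * (L\<^sub>F\<^sup>2 / (2 * \<sigma>))"
        unfolding V_def
        using mirror_step[OF assms(3,7,8,5) gk xQ u, of k "F (x k)" L\<^sub>F "x (Suc k)"]
          k xQ assms(13,20) by auto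
      \<comment> \<open>The multiplier \<open>w k / \<gamma> k\<close> turns the step size on the
        left into the averaging weight \<open>w k\<close>.\<close>
      then have "w k / \<gamma> k * (\<gamma> k * blinfun_apply (F (x k)) (x k - u))
          \<le> w k / \<gamma> k * (V k - V (Suc k) + (\<gamma> k)\<^sup>2 * (1 / c\<^sup>2))"
        unfolding c2 using gk w(2)[OF k] by (intro mult_left_mono) auto
      then have "w k * blinfun_apply (F (x k)) (x k - u)
          \<le> w k / \<gamma> k * (V k - V (Suc k)) + w k * \<gamma> k * (1 / c\<^sup>2)"
        using gk by (simp add: distrib_left power2_eq_square)
      \<comment> \<open>Since \<open>m \<ge> 1\<close> the exponent is nonnegative, so the value at
        \<open>N\<close> dominates; \<open>N\<close> such terms add up to the power
        \<open>(m + 1) / 2\<close>.\<close>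
      also have "w k * \<gamma> k * (1 / c\<^sup>2) \<le> K * real N powr ((m - 1) / 2)"
        unfolding w_mult[OF k] using K k \<open>m \<ge> 1\<close> by (intro mult_left_mono powr_mono2) auto
      finally have "w k * blinfun_apply (F (x k)) (x k - u)
          \<le> w k / \<gamma> k * (V k - V (Suc k)) + K * real N powr ((m - 1) / 2)" by simp
      \<comment> \<open>The loss \<open>\<delta>\<close> is the same for every \<open>k\<close>, so
        after weighting and division by \<open>W\<close> it contributes just
        \<open>\<delta>\<close>.\<close>
      moreover have "blinfun_apply (F u) (x k - u) \<le> blinfun_apply (F (x k)) (x k - u) + \<delta>"
        using assms(15) u xQ[of k] k
        by (force simp: delta_monotone_on_def blinfun.diff_left)
      then have "w k * blinfun_apply (F u) (x k - u)
          \<le> w k * (blinfun_apply (F (x k)) (x k - u) + \<delta>)"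
        using w(2)[OF k] by (intro mult_left_mono) auto
      ultimately show ?thesis by (simp add: distrib_left mult.commute)
    qed
    then have "(\<Sum>k=1..N. w k * blinfun_apply (F u) (x k - u))
        \<le> (\<Sum>k=1..N. w k / \<gamma> k * (V k - V (Suc k)) + K * real N powr ((m - 1) / 2) + \<delta> * w k)"
      by (rule sum_mono)
    also have "\<dots> = (\<Sum>k=1..N. w k / \<gamma> k * (V k - V (Suc k)))
        + real N * (K * real N powr ((m - 1) / 2)) + \<delta> * W"
      by (simp add: sum.distrib sum_distrib_left W_def)
    also have "(\<Sum>k=1..N. w k / \<gamma> k * (V k - V (Suc k))) \<le> w N / \<gamma> N * (R - V (Suc N))"
    proof (rule sum_weighted_telescope_le)
      show "w 1 / \<gamma> 1 \<ge> 0"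
        using w_div[of 1] K \<open>N \<ge> 1\<close> by simp
      show "w k / \<gamma> k \<le> w (Suc k) / \<gamma> (Suc k)" if "1 \<le> k" "k < N" for k
        using w_div[of k] w_div[of "Suc k"] that K \<open>m \<ge> 1\<close>
        by (auto intro!: mult_left_mono powr_mono2)
      show "V k \<le> R" if "1 \<le> k" "k \<le> N" for k
        using assms(10) u xQ[of k] that by (simp add: V_def)
    qed fact
    also have "w N / \<gamma> N * (R - V (Suc N)) \<le> K * real N powr ((m + 1) / 2) * R"
    proof -
      have "0 \<le> \<sigma> / 2 * (norm (u - x (Suc N)))\<^sup>2"
        using \<open>\<sigma> > 0\<close> by simp
      also have "\<dots> \<le> V (Suc N)"
        unfolding V_def using bregman_lower_bound[OF assms(7,8) xQ u] by simp
      finally show ?thesis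
        using w_div[of N] K \<open>N \<ge> 1\<close> by (simp add: mult_left_mono)
    qed
    also have "real N * (K * real N powr ((m - 1) / 2)) = K * real N powr ((m + 1) / 2)"
    proof -
      have "(m + 1) / 2 = 1 + (m - 1) / 2" by (simp add: field_simps)
      then have "real N powr ((m + 1) / 2) = real N powr 1 * real N powr ((m - 1) / 2)"
        by (simp only: powr_add)
      then show ?thesis by simp
    qed
    finally have "(\<Sum>k=1..N. w k * blinfun_apply (F u) (x k - u)) \<le> (B + \<delta>) * W"
      using B by (simp add: algebra_simps)
    \<comment> \<open>With \<open>F u\<close> in place of \<open>F (x k)\<close> the functional no
      longer depends on \<open>k\<close>, so linearity moves the average inside.\<close>
    moreover have "(\<Sum>k=1..N. w k * blinfun_apply (F u) (x k - u))
        = W * blinfun_apply (F u) (xhat - u)"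
    proof -
      have "xhat = (1 / W) *\<^sub>R (\<Sum>k=1..N. w k *\<^sub>R x k)"
        using assms(21) by (simp add: W_def w_def)
      then have "W * blinfun_apply (F u) xhat = (\<Sum>k=1..N. w k * blinfun_apply (F u) (x k))"
        using W by (simp add: blinfun.scaleR_right blinfun.sum_right)
      then show ?thesis
        by (simp add: blinfun.diff_right right_diff_distrib sum_subtractf sum_distrib_right W_def)
    qed
    ultimately show ?thesis using W by (simp add: mult.commute[of W])
  qed
  then show "Gap Q F xhat
      \<le> L\<^sub>F * (m + 2) * (1 + R) / (2 * sqrt (2 * \<sigma>)) * (1 / sqrt (real N)) + \<delta>"
    unfolding Gap_def B_def using \<open>Q \<noteq> {}\<close> by (intro cSUP_least) auto
  show "(\<lambda>n::nat. L\<^sub>F * (m + 2) * (1 + R) / (2 * sqrt (2 * \<sigma>)) * (1 / sqrt (real n)))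
      \<in> O(\<lambda>n. 1 / sqrt (real n))"
    by (rule bigoI[where c = "\<bar>L\<^sub>F * (m + 2) * (1 + R) / (2 * sqrt (2 * \<sigma>))\<bar>"])
      (simp add: abs_mult)
qed

end
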